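(* For any positive integer $n$, $$|B'_n|=\sum_{k=0}^{\binom{n}{2}} i_{B'}(n,k) = (2n-1)!!,$$ where $(2n-1)!!=1\times 3 \times\cdots \times (2n-1)$.
   Context: For $n\ge 1$, $B'_n$ denotes the set of overlined permutations of $\{1,\dots,n\}$ of the following kind: an element is a permutation $\sigma=\sigma_1\sigma_2\cdots\sigma_n$ of $\{1,\dots,n\}$ (in one-line notation) in which each entry $\sigma_i$ is independently either overlined or not overlined, subject to the condition that $\sigma_i$ may be overlined only if there is an index $j>i$ with $\sigma_i>\sigma_j$ (overlines are ignored in comparing entries). An inversion of such an element is a pair of positions $i<j$ with $\sigma_i>\sigma_j$, again ignoring overlines. The over-Mahonian number $i_{B'}(n,k)$ is the number of elements of $B'_n$ with exactly $k$ inversions. *)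

theory Defs
  imports "HOL-Combinatorics.Multiset_Permutations"
begin

text \<open>
  An overlined word is a list in one-line notation; the Boolean component of an entry says
  whether that entry is overlined. List positions count from 0.
\<close>

type_synonym overlined_word = "(nat \<times> bool) list"

definition inversions :: "overlined_word \<Rightarrow> (nat \<times> nat) set" where
  "inversions w = {(i, j). i < j \<and> j < length w \<and> fst (w ! i) > fst (w ! j)}"

definition B' :: "nat \<Rightarrow> overlined_word set" where
  "B' n = {w. map fst w \<in> permutations_of_set {1..n} \<and>
     (\<forall>i<length w. snd (w ! i) \<longrightarrow>
        (\<exists>j. i < j \<and> j < length w \<and> fst (w ! i) > fst (w ! j)))}"

definition over_mahonian :: "nat \<Rightarrow> nat \<Rightarrow> nat" where
  "over_mahonian n k = card {w \<in> B' n. card (inversions w) = k}"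

end

theory Submission
  imports Defs
begin

text \<open>
  The product formula comes from reading a word from left to right. Whether an entry may be
  overlined depends only on that entry and on the set of entries to its right, so deleting the
  first entry of an admissible word leaves an admissible word on the remaining values, with no
  further constraint. If \<open>m\<close> values are available, each of them can come first, plain or
  overlined, except that the least one has nothing smaller to its right and must stay plain:
  this gives \<open>2 * m - 1\<close> possibilities (\<open>card_first_entries\<close>), and \<open>m\<close> descends
  from \<open>n\<close> to \<open>1\<close>. The remaining values are an arbitrary finite set, which is why the
  induction (\<open>card_overlined_arrangements\<close>) runs over arrangements of such sets and not
  over \<open>{1..n}\<close> alone.

  That the over-Mahonian numbers add up to \<open>card (B' n)\<close> only expresses that the number of
  inversions takes no value beyond \<open>n choose 2\<close> (\<open>card_inversions_le\<close>).
\<close>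

definition admissible_overlines :: "overlined_word \<Rightarrow> bool" where
  "admissible_overlines w \<longleftrightarrow>
     (\<forall>i<length w. snd (w ! i) \<longrightarrow>
        (\<exists>j. i < j \<and> j < length w \<and> fst (w ! i) > fst (w ! j)))"

definition overlined_arrangements :: "nat set \<Rightarrow> overlined_word set" where
  "overlined_arrangements A = {w. map fst w \<in> permutations_of_set A \<and> admissible_overlines w}"

text \<open>
  The value \<open>a\<close> is followed by all other elements of \<open>A\<close>, so a smaller entry stands to
  its right exactly when \<open>A\<close> contains a smaller element, whatever their order.
\<close>

definition first_entries :: "nat set \<Rightarrow> (nat \<times> bool) set" where
  "first_entries A = {(a, b). a \<in> A \<and> (b \<longrightarrow> (\<exists>y\<in>A. y < a))}"

lemma B'_eq_overlined_arrangements: "B' n = overlined_arrangements {1..n}"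
  by (simp add: B'_def overlined_arrangements_def admissible_overlines_def)

lemma admissible_overlines_Cons:
  "admissible_overlines (x # w) \<longleftrightarrow>
     (snd x \<longrightarrow> (\<exists>y\<in>fst ` set w. y < fst x)) \<and> admissible_overlines w"
proof -
  have head: "(\<exists>j. 0 < j \<and> j < length (x # w) \<and> fst x > fst ((x # w) ! j)) \<longleftrightarrow>
      (\<exists>y\<in>fst ` set w. y < fst x)"
  proof -
    have "(\<exists>j. 0 < j \<and> j < length (x # w) \<and> fst x > fst ((x # w) ! j)) \<longleftrightarrow>
        (\<exists>j<length w. fst x > fst (w ! j))"
      by (metis Suc_less_eq gr0_conv_Suc length_Cons nth_Cons_Suc)
    also have "\<dots> \<longleftrightarrow> (\<exists>y\<in>fst ` set w. y < fst x)"
      unfolding set_conv_nth by blast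
    finally show ?thesis .
  qed
  have tail: "(\<exists>j. Suc i < j \<and> j < length (x # w) \<and> fst (w ! i) > fst ((x # w) ! j)) \<longleftrightarrow>
      (\<exists>j. i < j \<and> j < length w \<and> fst (w ! i) > fst (w ! j))" for i
    by (auto simp: Suc_less_eq2)
  show ?thesis
    unfolding admissible_overlines_def by (simp only: length_Cons All_less_Suc2 nth_Cons_0
        nth_Cons_Suc head[unfolded length_Cons] tail[unfolded length_Cons])
qed

lemma overlined_arrangements_empty: "overlined_arrangements {} = {[]}"
  by (auto simp: overlined_arrangements_def admissible_overlines_def)

lemma finite_overlined_arrangements:
  assumes "finite A"
  shows "finite (overlined_arrangements A)"
proof (rule finite_subset)
  show "overlined_arrangements A \<subseteq> {w. set w \<subseteq> A \<times> UNIV \<and> length w = card A}"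
    by (force simp: overlined_arrangements_def permutations_of_set_def
        dest: distinct_card)
  show "finite {w. set w \<subseteq> A \<times> (UNIV :: bool set) \<and> length w = card A}"
    using assms by (intro finite_lists_length_eq) auto
qed

text \<open>
  The choices for the first entry and for the rest of the word are independent except for the
  value that is used up, so the words are counted by a sum over the first entry.
\<close>

lemma overlined_arrangements_nonempty:
  assumes "A \<noteq> {}"
  shows "overlined_arrangements A =
    (\<lambda>(x, w). x # w) ` (SIGMA x:first_entries A. overlined_arrangements (A - {fst x}))"
    (is "?L = ?R")
proof -
  have "w \<in> ?L \<longleftrightarrow> w \<in> ?R" for w
  proof (cases w)
    case Nil
    then show ?thesis
      using assms by (auto simp: overlined_arrangements_def permutations_of_set_def)
  next
    case (Cons x v)
    have entries: "map fst w \<in> permutations_of_set A \<longleftrightarrow>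
        fst x \<in> A \<and> map fst v \<in> permutations_of_set (A - {fst x})"
      unfolding Cons permutations_of_set_def by (simp del: set_map) blast
    \<comment> \<open>Adding the first value itself to the values on its right creates no smaller one.\<close>
    have overline: "(\<exists>y\<in>fst ` set v. y < fst x) \<longleftrightarrow> (\<exists>y\<in>A. y < fst x)"
      if "map fst v \<in> permutations_of_set (A - {fst x})"
    proof -
      have "fst ` set v = A - {fst x}"
        using that by (simp add: permutations_of_set_def)
      then show ?thesis by auto
    qed
    have "w \<in> ?L \<longleftrightarrow> x \<in> first_entries A \<and> v \<in> overlined_arrangements (A - {fst x})"
      using entries overline
      by (auto simp: overlined_arrangements_def first_entries_def Cons admissible_overlines_Cons
          case_prod_beta)
    also have "\<dots> \<longleftrightarrow> w \<in> ?R"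
      by (auto simp: Cons)
    finally show ?thesis .
  qed
  then show ?thesis by blast
qed

lemma card_first_entries:
  assumes "finite A" "A \<noteq> {}"
  shows "card (first_entries A) = 2 * card A - 1"
proof -
  have "(\<exists>y\<in>A. y < a) \<longleftrightarrow> a \<noteq> Min A" if "a \<in> A" for a
    using assms that by (metis Min_in Min_le le_less not_less)
  then have "first_entries A = A \<times> {False} \<union> (A - {Min A}) \<times> {True}"
    by (auto simp: first_entries_def)
  moreover have "card (A \<times> {False} \<union> (A - {Min A}) \<times> {True}) = card A + card (A - {Min A})"
    using assms by (subst card_Un_disjoint) auto
  moreover have "card A > 0"
    using assms by (simp add: card_gt_0_iff)
  ultimately show ?thesis
    using assms by (simp add: card_Diff_singleton)
qed

lemma card_overlined_arrangements:
  assumes "finite A"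
  shows "card (overlined_arrangements A) = (\<Prod>i = 1..card A. (2 * i - 1))"
  using assms
proof (induction "card A" arbitrary: A)
  case 0
  then show ?case by (simp add: overlined_arrangements_empty)
next
  case (Suc m)
  then have nonempty: "A \<noteq> {}" by auto
  have first: "card (first_entries A) = 2 * Suc m - 1"
    using card_first_entries[OF Suc.prems nonempty] Suc.hyps(2) by simp
  then have fin: "finite (first_entries A)"
    by (intro card_ge_0_finite) simp
  have rest: "card (overlined_arrangements (A - {fst x})) = (\<Prod>i = 1..m. (2 * i - 1))"
    if "x \<in> first_entries A" for x
  proof -
    have "card (A - {fst x}) = m"
      using that Suc.hyps(2) by (auto simp: first_entries_def)
    then show ?thesis using Suc.hyps(1)[of "A - {fst x}"] Suc.prems by simp
  qed
  have "card (overlined_arrangements A) =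
      card (SIGMA x:first_entries A. overlined_arrangements (A - {fst x}))"
    unfolding overlined_arrangements_nonempty[OF nonempty]
    by (rule card_image) (auto simp: inj_on_def)
  also have "\<dots> = (\<Sum>x\<in>first_entries A. card (overlined_arrangements (A - {fst x})))"
    using fin Suc.prems by (simp add: card_SigmaI finite_overlined_arrangements)
  also have "\<dots> = (2 * Suc m - 1) * (\<Prod>i = 1..m. (2 * i - 1))"
    using rest first by simp
  also have "\<dots> = (\<Prod>i = 1..card A. (2 * i - 1))"
    by (simp flip: Suc.hyps(2))
  finally show ?case .
qed

text \<open>
  Since an inversion lists the smaller position first, it is recovered from the unordered pair
  of its positions.
\<close>

lemma card_inversions_le: "card (inversions w) \<le> length w choose 2"
proof -
  have "card (inversions w) \<le> card {P. P \<subseteq> {..<length w} \<and> card P = 2}"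
  proof (rule card_inj_on_le[where f = "\<lambda>(i, j). {i, j}"])
    show "inj_on (\<lambda>(i, j). {i, j}) (inversions w)"
      by (auto simp: inj_on_def inversions_def doubleton_eq_iff)
    show "(\<lambda>(i, j). {i, j}) ` inversions w \<subseteq> {P. P \<subseteq> {..<length w} \<and> card P = 2}"
      by (auto simp: inversions_def card_insert_if)
    show "finite {P. P \<subseteq> {..<length w} \<and> card P = 2}"
      by simp
  qed
  then show ?thesis by (simp add: n_subsets)
qed

lemma card_B'_eq_sum_over_mahonian:
  "card (B' n) = (\<Sum>k = 0..n choose 2. over_mahonian n k)"
proof -
  have fin: "finite (B' n)"
    by (simp add: B'_eq_overlined_arrangements finite_overlined_arrangements)
  have "length w = n" if "w \<in> B' n" for w
    using that length_finite_permutations_of_set[of "map fst w" "{1..n}"] by (simp add: B'_def)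
  then have "(\<lambda>w. card (inversions w)) ` B' n \<subseteq> {0..n choose 2}"
    using card_inversions_le by fastforce
  with fin have "(\<Sum>k = 0..n choose 2. \<Sum>w | w \<in> B' n \<and> card (inversions w) = k. 1) =
      (\<Sum>w\<in>B' n. 1::nat)"
    by (intro sum.group) auto
  then show ?thesis by (simp add: over_mahonian_def)
qed

theorem corollary2p11:
  fixes n :: nat
  assumes "n \<ge> 1"
  shows "card (B' n) = (\<Sum>k = 0..n choose 2. over_mahonian n k) \<and>
         (\<Sum>k = 0..n choose 2. over_mahonian n k) = (\<Prod>i = 1..n. (2 * i - 1))"
  using card_B'_eq_sum_over_mahonian[of n] card_overlined_arrangements[of "{1..n}"]
  by (simp add: B'_eq_overlined_arrangements)

end
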